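(* Let $N=\{1,\dots,n\}$, $1>q_1\ge\dots\ge q_n\ge0$, and $f(\mathbf{x})=\max\{0,\max_{i\in N}\{q_i-x_i\}\}$ for $\mathbf{x}\in\mathbb{Z}^n$. Let $K\subseteq N$, and let $\boldsymbol\sigma=(\sigma(1),\dots,\sigma(|K|))$ be any (in case of ties) ordering of the elements of $K$ such that $q_{\sigma(1)}\ge\dots\ge q_{\sigma(|K|)}$, with the convention $q_{\sigma(|K|+1)}=0$. Then the mixing inequality $$w\ge\sum_{k=1}^{|K|}(q_{\sigma(k)}-q_{\sigma(k+1)})(1-x_{\sigma(k)})$$ with respect to $K$ is identical to the SEPI for $f$ associated with $\mathbf{p}\in\mathbb{Z}^n$, where $p_i=0$ for $i\in K$ and $p_i=1$ otherwise, and the natural ordering $\boldsymbol\delta=(1,\dots,n)$.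
   Context: For $\mathbf{p}\in\mathbb{Z}^n$ and a permutation $\boldsymbol\delta$ of $N$, the SEPI (shifted extremal polymatroid inequality) for $f:\mathbb{Z}^n\to\mathbb{R}$ associated with $(\mathbf{p},\boldsymbol\delta)$ is $$w\ge f(\mathbf{p})+\sum_{i=1}^n\Big[f\Big(\mathbf{p}+\sum_{j=1}^{i}\mathbf{1}^{\delta(j)}\Big)-f\Big(\mathbf{p}+\sum_{j=1}^{i-1}\mathbf{1}^{\delta(j)}\Big)\Big](x_{\delta(i)}-p_{\delta(i)}),$$ with $\mathbf{1}^i$ the $i$-th unit vector. The epigraph of $f$ is the general integer mixing set $\{(w,\mathbf{x})\in\mathbb{R}_+\times\mathbb{Z}^n:w+x_i\ge q_i\ \forall i\in N\}$.
   Formalization: With ties among the q_i the claim for any σ and δ=(1,…,n) fails (q=(1/2,1/2), K={1,2}, σ=(2,1)); proved for δ=(1,…,n) when σ lists tied elements of K in index order, and for any σ with some δ that permutes only indices of equal q. *)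

theory Defs
  imports Complex_Main "HOL-Combinatorics.Permutations"
begin

text \<open>
  Vectors in \<open>\<int>\<^sup>n\<close> and \<open>\<real>\<^sup>n\<close> are functions on \<open>nat\<close> of which only the
  coordinates in \<open>{1..n}\<close> matter. A linear inequality \<open>w \<ge> a\<^sub>0 + (\<Sum>i=1..n. a\<^sub>i * x\<^sub>i)\<close> is
  represented by its right-hand side as a function of a real vector \<open>x\<close>; two such
  inequalities have the same coefficients iff these functions are equal.
\<close>

definition unit_vec :: "nat \<Rightarrow> nat \<Rightarrow> int" where
  "unit_vec i = (\<lambda>j. if j = i then 1 else 0)"

definition partial_point :: "(nat \<Rightarrow> int) \<Rightarrow> (nat \<Rightarrow> nat) \<Rightarrow> nat \<Rightarrow> nat \<Rightarrow> int" where
  "partial_point p \<delta> i = (\<lambda>l. p l + (\<Sum>j=1..i. unit_vec (\<delta> j) l))"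

definition sepi_rhs ::
  "nat \<Rightarrow> ((nat \<Rightarrow> int) \<Rightarrow> real) \<Rightarrow> (nat \<Rightarrow> int) \<Rightarrow> (nat \<Rightarrow> nat) \<Rightarrow> (nat \<Rightarrow> real) \<Rightarrow> real" where
  "sepi_rhs n f p \<delta> x =
     f p + (\<Sum>i=1..n. (f (partial_point p \<delta> i) - f (partial_point p \<delta> (i - 1)))
                        * (x (\<delta> i) - of_int (p (\<delta> i))))"

definition mixing_fun :: "nat \<Rightarrow> (nat \<Rightarrow> real) \<Rightarrow> (nat \<Rightarrow> int) \<Rightarrow> real" where
  "mixing_fun n q x = max 0 (MAX i\<in>{1..n}. q i - of_int (x i))"

text \<open>The conditional encodes the convention \<open>q (\<sigma> (card K + 1)) = 0\<close>.\<close>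

definition mixing_rhs ::
  "(nat \<Rightarrow> real) \<Rightarrow> nat set \<Rightarrow> (nat \<Rightarrow> nat) \<Rightarrow> (nat \<Rightarrow> real) \<Rightarrow> real" where
  "mixing_rhs q K \<sigma> x =
     (\<Sum>k=1..card K. (q (\<sigma> k) - (if k = card K then 0 else q (\<sigma> (k + 1)))) * (1 - x (\<sigma> k)))"

text \<open>
  The mixing inequality depends on how \<open>\<sigma>\<close> breaks ties: for \<open>n = 2\<close>, \<open>q\<^sub>1 = q\<^sub>2 = 1/2\<close> and
  \<open>K = {1, 2}\<close>, the ordering \<open>\<sigma> = (1, 2)\<close> gives \<open>w \<ge> (1 - x\<^sub>2) / 2\<close>, whereas \<open>\<sigma> = (2, 1)\<close>
  gives \<open>w \<ge> (1 - x\<^sub>1) / 2\<close>. Only the former is the SEPI of the natural ordering \<open>(1, 2)\<close>;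
  the latter is the SEPI of the ordering \<open>(2, 1)\<close>, which is the natural one once the
  tied indices are relabelled. The following condition says that \<open>\<sigma>\<close> lists tied elements in
  their natural order; it is vacuous if there are no ties in \<open>K\<close>.
\<close>

definition ties_in_natural_order :: "(nat \<Rightarrow> real) \<Rightarrow> nat set \<Rightarrow> (nat \<Rightarrow> nat) \<Rightarrow> bool" where
  "ties_in_natural_order q K \<sigma> \<longleftrightarrow>
     (\<forall>k l. 1 \<le> k \<and> k < l \<and> l \<le> card K \<and> q (\<sigma> k) = q (\<sigma> l) \<longrightarrow> \<sigma> k < \<sigma> l)"

end

(*
  Let tau enumerate K increasingly, and let delta map tau(k) to sigma(k) and fix all indices outside
  K. After i steps along delta, f equals the largest q over the not yet raised elements of K, that
  is q(sigma(c + 1)) where c counts the k with tau(k) <= i (and 0 if c = |K|). The step i therefore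
  contributes a term only if i = tau(k), and this term has the coefficient of x(sigma(k)) in the
  mixing inequality; the constants agree by telescoping. Since sigma and tau both sort K by
  decreasing q, delta only permutes tied indices, and without badly ordered ties sigma is
  increasing, so that one can take tau = sigma and delta = id.
*)
theory Submission
  imports Defs "HOL-Library.Multiset"
begin

text \<open>As \<open>\<delta>\<close> is injective on the first \<open>i\<close> steps, each unit
  vector enters the sum at most once. So every coordinate is raised by 0 or 1.\<close>

lemma partial_point_eq:
  assumes "inj_on \<delta> {1..i}"
  shows "partial_point p \<delta> i l = p l + (if l \<in> \<delta> ` {1..i} then 1 else 0)"
proof -
  have "(\<Sum>j=1..i. unit_vec (\<delta> j) l) = (\<Sum>j\<in>\<delta> ` {1..i}. unit_vec j l)"
    using sum.reindex[OF assms, of "\<lambda>j. unit_vec j l"] by simp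
  also have "\<dots> = (if l \<in> \<delta> ` {1..i} then 1 else 0)"
    by (simp add: unit_vec_def)
  finally show ?thesis
    by (simp add: partial_point_def)
qed

text \<open>A coordinate that is at least 1 contributes at most 0 to the maximum, because
  \<open>q\<close> is at most 1. Among the coordinates at 0, the first one in the order of
  \<open>\<sigma>\<close> has the largest \<open>q\<close>; if none is left, the 0 in
  \<open>mixing_fun\<close> wins. The bound \<open>1 \<le> y i\<close> is not an equality because
  indices outside K start at 1 and are raised to 2.\<close>

lemma mixing_fun_eq:
  fixes q :: "nat \<Rightarrow> real" and c m :: nat
  assumes "n \<ge> 1"
    and q: "\<And>i. i \<in> {1..n} \<Longrightarrow> 0 \<le> q i \<and> q i \<le> 1"
    and sub: "\<sigma> ` {c + 1..m} \<subseteq> {1..n}"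
    and anti: "\<And>k l. 1 \<le> k \<Longrightarrow> k \<le> l \<Longrightarrow> l \<le> m \<Longrightarrow> q (\<sigma> l) \<le> q (\<sigma> k)"
    and zero: "\<And>i. i \<in> \<sigma> ` {c + 1..m} \<Longrightarrow> y i = 0"
    and one: "\<And>i. i \<in> {1..n} \<Longrightarrow> i \<notin> \<sigma> ` {c + 1..m} \<Longrightarrow> 1 \<le> y i"
  shows "mixing_fun n q y = (if c < m then q (\<sigma> (c + 1)) else 0)"
proof (cases "c < m")
  case True
  then have mem: "\<sigma> (c + 1) \<in> \<sigma> ` {c + 1..m}"
    by auto
  have "(MAX i\<in>{1..n}. q i - of_int (y i)) = q (\<sigma> (c + 1))"
  proof (rule Max_eqI)
    show "q (\<sigma> (c + 1)) \<in> (\<lambda>i. q i - of_int (y i)) ` {1..n}"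
      using mem sub zero[OF mem] by (intro image_eqI[of _ _ "\<sigma> (c + 1)"]) auto
  next
    fix z assume "z \<in> (\<lambda>i. q i - of_int (y i)) ` {1..n}"
    then obtain i where i: "i \<in> {1..n}" "z = q i - of_int (y i)"
      by blast
    show "z \<le> q (\<sigma> (c + 1))"
    proof (cases "i \<in> \<sigma> ` {c + 1..m}")
      case True
      then obtain j where "j \<in> {c + 1..m}" "i = \<sigma> j"
        by blast
      then show ?thesis
        using i zero[OF True] anti[of "c + 1" j] by auto
    next
      case False
      then have "1 \<le> y i"
        using one i(1) by blast
      moreover have "0 \<le> q (\<sigma> (c + 1))"
        using mem sub q by blast
      ultimately show ?thesis
        using i q[OF i(1)] by simp
    qed
  qed simp
  moreover have "0 \<le> q (\<sigma> (c + 1))"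
    using mem sub q by blast
  ultimately show ?thesis
    using True by (simp add: mixing_fun_def)
next
  case False
  have "(MAX i\<in>{1..n}. q i - of_int (y i)) \<le> 0"
  proof (subst Max_le_iff)
    show "\<forall>z\<in>(\<lambda>i. q i - of_int (y i)) ` {1..n}. z \<le> 0"
    proof
      fix z assume "z \<in> (\<lambda>i. q i - of_int (y i)) ` {1..n}"
      then obtain i where i: "i \<in> {1..n}" "z = q i - of_int (y i)"
        by blast
      have "1 \<le> y i"
        using one[OF i(1)] False by simp
      then show "z \<le> 0"
        using i(2) q[OF i(1)] by simp
    qed
  qed (use assms(1) in auto)
  then show ?thesis
    using False by (simp add: mixing_fun_def)
qed

text \<open>Serves to recover the set of positions reached after some steps from its cardinality
  alone: an increasing enumeration is always reached in an initial segment.\<close>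

lemma down_closed_eq_atLeastAtMost:
  fixes D :: "nat set"
  assumes "finite D" "0 \<notin> D" and down: "\<And>j k. k \<in> D \<Longrightarrow> 1 \<le> j \<Longrightarrow> j \<le> k \<Longrightarrow> j \<in> D"
  shows "D = {1..card D}"
proof -
  have "D \<subseteq> {1..card D}"
  proof
    fix j assume j: "j \<in> D"
    then have "{1..j} \<subseteq> D"
      using down by auto
    then have "j \<le> card D"
      using card_mono[OF assms(1), of "{1..j}"] by simp
    then show "j \<in> {1..card D}"
      using j assms(2) by (cases j) auto
  qed
  then show ?thesis
    by (intro card_subset_eq) auto
qed

lemma image_Collect_notin: "f ` {k \<in> A. f k \<notin> B} = f ` A - B"
  by auto

text \<open>Keeping \<open>\<tau>\<close> and \<open>\<delta>\<close> general covers both halves of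
  the theorem: \<open>\<tau> = \<sigma>\<close> with the identity, and the increasing enumeration of
  K with a rearrangement of tied indices.\<close>

lemma sepi_rhs_eq_mixing_rhs:
  fixes n :: nat and q :: "nat \<Rightarrow> real" and p :: "nat \<Rightarrow> int"
  assumes n: "n \<ge> 1"
    and q: "\<And>i. i \<in> {1..n} \<Longrightarrow> 0 \<le> q i \<and> q i \<le> 1"
    and K: "K \<subseteq> {1..n}"
    and \<sigma>: "bij_betw \<sigma> {1..card K} K"
    and anti: "\<And>k l. 1 \<le> k \<Longrightarrow> k \<le> l \<Longrightarrow> l \<le> card K \<Longrightarrow> q (\<sigma> l) \<le> q (\<sigma> k)"
    and p: "\<And>i. i \<in> {1..n} \<Longrightarrow> p i = (if i \<in> K then 0 else 1)"
    and \<tau>: "bij_betw \<tau> {1..card K} K" "strict_mono_on {1..card K} \<tau>"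
    and \<delta>: "\<delta> permutes {1..n}" "\<And>k. k \<in> {1..card K} \<Longrightarrow> \<delta> (\<tau> k) = \<sigma> k"
  shows "sepi_rhs n (mixing_fun n q) p \<delta> x = mixing_rhs q K \<sigma> x"
proof -
  define m where "m = card K"
  \<comment> \<open>\<open>D i\<close> collects the positions in \<open>\<sigma>\<close> of the
    elements of K that are raised in the first \<open>i\<close> steps. \<open>Q k\<close> is the
    value of the function once the first \<open>k\<close> elements of \<open>\<sigma>\<close> are
    raised; \<open>Q m = 0\<close> is the convention for the index after the last.\<close>
  define D where "D = (\<lambda>i. {k \<in> {1..m}. \<tau> k \<le> i})"
  define Q where "Q = (\<lambda>k. if k < m then q (\<sigma> (k + 1)) else 0)"
  define F where "F = (\<lambda>i. mixing_fun n q (partial_point p \<delta> i))"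
  note \<sigma> = \<sigma>[folded m_def] and anti = anti[folded m_def]
    and \<tau> = \<tau>[folded m_def] and \<delta> = \<delta>[folded m_def]
  have \<tau>_le: "\<tau> j \<le> \<tau> k \<longleftrightarrow> j \<le> k" if "j \<in> {1..m}" "k \<in> {1..m}" for j k
    using strict_mono_on_less_eq[OF \<tau>(2)] that by blast
  have inj: "inj \<delta>"
    using \<delta>(1) by (rule permutes_inj)
  have D: "D i = {1..card (D i)}" for i
  proof (rule down_closed_eq_atLeastAtMost)
    fix j k assume "k \<in> D i" "1 \<le> j" "j \<le> k"
    then show "j \<in> D i"
      using \<tau>_le[of j k] by (auto simp: D_def)
  qed (auto simp: D_def)
  have F: "F i = Q (card (D i))" if i: "i \<le> n" for i
  proof -
    \<comment> \<open>The elements of K still at 0 form a tail of \<open>\<sigma>\<close>: since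
      \<open>\<delta>\<close> is injective and sends \<open>\<tau> k\<close> to
      \<open>\<sigma> k\<close>, the element \<open>\<sigma> k\<close> is raised by step
      \<open>i\<close> exactly if \<open>\<tau> k \<le> i\<close>.\<close>
    have K_diff: "\<sigma> ` {card (D i) + 1..m} = K - \<delta> ` {1..i}"
    proof -
      have reached: "k \<le> card (D i) \<longleftrightarrow> \<sigma> k \<in> \<delta> ` {1..i}" if k: "k \<in> {1..m}" for k
      proof -
        have "1 \<le> \<tau> k"
          using bij_betwE[OF \<tau>(1)] k K by fastforce
        then have "\<delta> (\<tau> k) \<in> \<delta> ` {1..i} \<longleftrightarrow> \<tau> k \<le> i"
          using inj by (simp add: inj_image_mem_iff)
        also have "\<dots> \<longleftrightarrow> k \<in> D i"
          using k by (simp add: D_def)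
        also have "\<dots> \<longleftrightarrow> k \<le> card (D i)"
          using k by (metis D atLeastAtMost_iff)
        finally show ?thesis
          using \<delta>(2) k by simp
      qed
      have "{card (D i) + 1..m} = {k \<in> {1..m}. \<not> k \<le> card (D i)}"
        by auto
      also have "\<dots> = {k \<in> {1..m}. \<sigma> k \<notin> \<delta> ` {1..i}}"
        using reached by blast
      finally have eq: "{card (D i) + 1..m} = {k \<in> {1..m}. \<sigma> k \<notin> \<delta> ` {1..i}}" .
      have "\<sigma> ` {card (D i) + 1..m} = \<sigma> ` {1..m} - \<delta> ` {1..i}"
        unfolding eq by (rule image_Collect_notin)
      then show ?thesis
        using \<sigma> by (simp add: bij_betw_def)
    qed
    have pp: "partial_point p \<delta> i l = p l + (if l \<in> \<delta> ` {1..i} then 1 else 0)" for l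
      using inj by (intro partial_point_eq) (blast intro: inj_on_subset)
    show ?thesis
      unfolding F_def Q_def
    proof (rule mixing_fun_eq[OF n q])
      show "\<sigma> ` {card (D i) + 1..m} \<subseteq> {1..n}"
        using K_diff K by blast
      show "q (\<sigma> l) \<le> q (\<sigma> k)" if "1 \<le> k" "k \<le> l" "l \<le> m" for k l
        using anti that by blast
    next
      fix l assume "l \<in> \<sigma> ` {card (D i) + 1..m}"
      then show "partial_point p \<delta> i l = 0"
        using K_diff K p[of l] by (auto simp: pp)
    next
      fix l assume "l \<in> {1..n}" "l \<notin> \<sigma> ` {card (D i) + 1..m}"
      then show "1 \<le> partial_point p \<delta> i l"
        using K_diff p[of l] by (auto simp: pp)
    qed
  qed
  \<comment> \<open>Step \<open>\<tau> k\<close> raises exactly the \<open>k\<close>-th element of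
    \<open>\<sigma>\<close>. The bound \<open>1 \<le> \<tau> k\<close> makes
    \<open>\<tau> j \<le> \<tau> k - 1\<close> mean \<open>\<tau> j < \<tau> k\<close> despite
    truncated subtraction.\<close>
  have D_\<tau>: "card (D (\<tau> k)) = k" "card (D (\<tau> k - 1)) = k - 1" if k: "k \<in> {1..m}" for k
  proof -
    have "1 \<le> \<tau> k"
      using bij_betwE[OF \<tau>(1)] k K by fastforce
    then have "\<tau> j \<le> \<tau> k - 1 \<longleftrightarrow> \<not> \<tau> k \<le> \<tau> j" for j
      by linarith
    then have "D (\<tau> k - 1) = {1..k - 1}" "D (\<tau> k) = {1..k}"
      using \<tau>_le k by (auto simp: D_def)
    then show "card (D (\<tau> k)) = k" "card (D (\<tau> k - 1)) = k - 1"
      by simp_all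
  qed
  \<comment> \<open>A step at an index outside K raises no element of K, so the function value stays
    and the coefficient vanishes. This restricts the sum to K.\<close>
  have D_const: "D i = D (i - 1)" if i: "i \<in> {1..n} - K" for i
  proof -
    have "\<tau> k \<noteq> i" if "k \<in> {1..m}" for k
      using bij_betwE[OF \<tau>(1)] that i by blast
    then show ?thesis
      using i by (auto simp: D_def le_less)
  qed
  have p_\<sigma>: "p (\<sigma> k) = 0" if "k \<in> {1..m}" for k
    using bij_betwE[OF \<sigma>] p K that by (metis subsetD)
  have "(\<Sum>i=1..n. (F i - F (i - 1)) * (x (\<delta> i) - of_int (p (\<delta> i))))
      = (\<Sum>i\<in>K. (F i - F (i - 1)) * (x (\<delta> i) - of_int (p (\<delta> i))))"
    using K D_const by (intro sum.mono_neutral_right) (auto simp: F)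
  also have "\<dots> = (\<Sum>k=1..m. (F (\<tau> k) - F (\<tau> k - 1)) * (x (\<delta> (\<tau> k)) - of_int (p (\<delta> (\<tau> k)))))"
    by (rule sum.reindex_bij_betw[OF \<tau>(1), symmetric])
  also have "\<dots> = (\<Sum>k=1..m. (Q k - Q (k - 1)) * x (\<sigma> k))"
  proof (rule sum.cong)
    fix k assume k: "k \<in> {1..m}"
    then have "\<tau> k \<le> n"
      using bij_betwE[OF \<tau>(1)] K by fastforce
    then show "(F (\<tau> k) - F (\<tau> k - 1)) * (x (\<delta> (\<tau> k)) - of_int (p (\<delta> (\<tau> k))))
        = (Q k - Q (k - 1)) * x (\<sigma> k)"
      using D_\<tau>[OF k] p_\<sigma>[OF k] \<delta>(2)[OF k] by (simp add: F)
  qed simp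
  finally have sum: "(\<Sum>i=1..n. (F i - F (i - 1)) * (x (\<delta> i) - of_int (p (\<delta> i))))
      = (\<Sum>k=1..m. (Q k - Q (k - 1)) * x (\<sigma> k))" .
  \<comment> \<open>All values of \<open>\<tau>\<close> are at least 1, so the constant term is the
    case \<open>i = 0\<close> of \<open>F\<close>.\<close>
  have "D 0 = {}"
    using bij_betwE[OF \<tau>(1)] K by (fastforce simp: D_def)
  moreover have "partial_point p \<delta> 0 = p"
    by (simp add: partial_point_def)
  ultimately have const: "mixing_fun n q p = Q 0"
    using F[of 0] by (simp add: F_def)
  \<comment> \<open>Subtracting \<open>Q m = 0\<close> lets the constant be spread over the sum:
    each coefficient \<open>Q (k - 1) - Q k\<close> then multiplies
    \<open>1 - x (\<sigma> k)\<close>.\<close>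
  have "Q 0 = Q 0 - Q m"
    by (simp add: Q_def)
  also have "\<dots> = (\<Sum>k=1..m. Q (k - 1) - Q k)"
    using sum_telescope''[of 0 m Q] by (simp add: sum_subtractf atLeastSucAtMost_greaterThanAtMost)
  finally have "Q 0 + (\<Sum>k=1..m. (Q k - Q (k - 1)) * x (\<sigma> k))
      = (\<Sum>k=1..m. (Q (k - 1) - Q k) * (1 - x (\<sigma> k)))"
    by (simp add: sum.distrib[symmetric] algebra_simps)
  also have "\<dots> = mixing_rhs q K \<sigma> x"
    unfolding mixing_rhs_def m_def[symmetric] by (intro sum.cong) (auto simp: Q_def)
  finally show ?thesis
    using sum const by (simp add: sepi_rhs_def F_def)
qed

text \<open>Along either enumeration the values of \<open>q\<close> are a sorted list of the same
  multiset, and such a list is unique. With ties this holds for the values only, not for the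
  indices.\<close>

lemma sorted_rearrangement_unique:
  fixes q :: "'a \<Rightarrow> real" and m :: nat
  assumes \<sigma>: "bij_betw \<sigma> {1..m} K" and \<tau>: "bij_betw \<tau> {1..m} K"
    and anti_\<sigma>: "\<And>k l. 1 \<le> k \<Longrightarrow> k \<le> l \<Longrightarrow> l \<le> m \<Longrightarrow> q (\<sigma> l) \<le> q (\<sigma> k)"
    and anti_\<tau>: "\<And>k l. 1 \<le> k \<Longrightarrow> k \<le> l \<Longrightarrow> l \<le> m \<Longrightarrow> q (\<tau> l) \<le> q (\<tau> k)"
    and k: "k \<in> {1..m}"
  shows "q (\<sigma> k) = q (\<tau> k)"
proof -
  \<comment> \<open>The minus sign turns decreasing lists into ones that are \<open>sorted\<close>.
    Lists count from 0, so \<open>q (\<rho> k)\<close> sits at position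
    \<open>k - 1\<close>.\<close>
  define L where "L = (\<lambda>\<rho>. map (\<lambda>k. - q (\<rho> k)) [1..<Suc m])"
  have mset: "mset (L \<rho>) = image_mset (\<lambda>i. - q i) (mset_set K)" if "bij_betw \<rho> {1..m} K" for \<rho>
  proof -
    have "mset (L \<rho>) = image_mset (\<lambda>i. - q i) (image_mset \<rho> (mset_set {1..m}))"
      by (simp add: L_def image_mset.compositionality comp_def atLeastLessThanSuc_atLeastAtMost
          del: upt_Suc)
    then show ?thesis
      using that by (simp add: image_mset_mset_set bij_betw_def)
  qed
  have sorted: "sorted (L \<rho>)"
    if "\<And>k l. 1 \<le> k \<Longrightarrow> k \<le> l \<Longrightarrow> l \<le> m \<Longrightarrow> q (\<rho> l) \<le> q (\<rho> k)" for \<rho>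
    unfolding sorted_iff_nth_mono using that by (auto simp: L_def simp del: upt_Suc)
  have "sort (L \<tau>) = L \<sigma>"
    using mset[OF \<sigma>] mset[OF \<tau>] sorted[OF anti_\<sigma>] by (intro properties_for_sort) simp_all
  then have "L \<sigma> = L \<tau>"
    using sorted_sort_id[OF sorted[OF anti_\<tau>]] by simp
  then have "L \<sigma> ! (k - 1) = L \<tau> ! (k - 1)"
    by simp
  moreover have "k - 1 < length [1..<Suc m]" "1 + (k - 1) = k" "k < Suc m"
    using k by auto
  ultimately show ?thesis
    by (simp add: L_def del: upt_Suc)
qed

text \<open>The sorted list of K does it; the shift \<open>k - 1\<close> bridges enumeration from 1
  and list positions from 0.\<close>

lemma ex_strict_mono_enumeration:
  fixes K :: "nat set"
  assumes "finite K"
  shows "\<exists>\<tau>. bij_betw \<tau> {1..card K} K \<and> strict_mono_on {1..card K} \<tau>"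
proof (intro exI conjI)
  let ?xs = "sorted_list_of_set K"
  have "bij_betw (\<lambda>k. k - 1) {1..card K} {..<card K}"
    by (rule bij_betwI[where g = Suc]) auto
  moreover have "bij_betw (\<lambda>k. ?xs ! k) {..<card K} K"
    using assms by (intro bij_betw_nth) auto
  ultimately show "bij_betw (\<lambda>k. ?xs ! (k - 1)) {1..card K} K"
    using bij_betw_trans by (force simp: comp_def)
  show "strict_mono_on {1..card K} (\<lambda>k. ?xs ! (k - 1))"
    using strict_sorted_list_of_set[of K]
    by (auto simp: strict_mono_on_def sorted_wrt_iff_nth_less)
qed

text \<open>The second conjunct covers every way to break ties: there \<open>\<delta>\<close>
  preserves \<open>q\<close>, so it is the natural ordering after relabelling indices with equal
  \<open>q\<close>.\<close>

theorem proposition3p10: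
  fixes n :: nat and q :: "nat \<Rightarrow> real" and K :: "nat set"
    and \<sigma> :: "nat \<Rightarrow> nat" and p :: "nat \<Rightarrow> int"
  assumes "n \<ge> 1"
    and "q 1 < 1"
    and "\<And>i j. 1 \<le> i \<Longrightarrow> i \<le> j \<Longrightarrow> j \<le> n \<Longrightarrow> q j \<le> q i"
    and "0 \<le> q n"
    and "K \<subseteq> {1..n}"
    and "bij_betw \<sigma> {1..card K} K"
    and "\<And>k l. 1 \<le> k \<Longrightarrow> k \<le> l \<Longrightarrow> l \<le> card K \<Longrightarrow> q (\<sigma> l) \<le> q (\<sigma> k)"
    and "\<And>i. i \<in> {1..n} \<Longrightarrow> p i = (if i \<in> K then 0 else 1)"
  shows "(ties_in_natural_order q K \<sigma> \<longrightarrow>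
            (\<forall>x :: nat \<Rightarrow> real. mixing_rhs q K \<sigma> x = sepi_rhs n (mixing_fun n q) p id x))
       \<and> (\<exists>\<delta>. \<delta> permutes {1..n} \<and> (\<forall>i\<in>{1..n}. q (\<delta> i) = q i) \<and>
            (\<forall>x :: nat \<Rightarrow> real. mixing_rhs q K \<sigma> x = sepi_rhs n (mixing_fun n q) p \<delta> x))"
proof -
  note anti = assms(3) and K = assms(5) and \<sigma> = assms(6) and anti_\<sigma> = assms(7)
  have q: "0 \<le> q i \<and> q i \<le> 1" if "i \<in> {1..n}" for i
    using that anti[of 1 i] anti[of i n] assms(2,4) by auto
  have eq: "mixing_rhs q K \<sigma> x = sepi_rhs n (mixing_fun n q) p \<delta> x"
    if "bij_betw \<tau> {1..card K} K" "strict_mono_on {1..card K} \<tau>" "\<delta> permutes {1..n}"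
      "\<And>k. k \<in> {1..card K} \<Longrightarrow> \<delta> (\<tau> k) = \<sigma> k" for \<tau> \<delta> x
    by (rule sepi_rhs_eq_mixing_rhs[symmetric]) (fact assms q that)+
  have natural: "mixing_rhs q K \<sigma> x = sepi_rhs n (mixing_fun n q) p id x"
    if ties: "ties_in_natural_order q K \<sigma>" for x
  proof (rule eq[OF \<sigma>])
    show "strict_mono_on {1..card K} \<sigma>"
    proof (rule strict_mono_onI)
      fix k l assume kl: "k \<in> {1..card K}" "l \<in> {1..card K}" "k < l"
      have mem: "\<sigma> k \<in> {1..n}" "\<sigma> l \<in> {1..n}"
        using bij_betwE[OF \<sigma>] K kl by blast+
      show "\<sigma> k < \<sigma> l"
      proof (cases "q (\<sigma> k) = q (\<sigma> l)")
        case True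
        then show ?thesis
          using ties kl by (simp add: ties_in_natural_order_def)
      next
        \<comment> \<open>Here \<open>q (\<sigma> l) < q (\<sigma> k)\<close>. As \<open>q\<close>
          decreases in the index, \<open>\<sigma> l \<le> \<sigma> k\<close> would give the opposite
          inequality.\<close>
        case False
        then have "\<not> q (\<sigma> k) \<le> q (\<sigma> l)"
          using anti_\<sigma>[of k l] kl by auto
        then show ?thesis
          using anti[of "\<sigma> l" "\<sigma> k"] mem by (meson atLeastAtMost_iff not_less)
      qed
    qed
  qed (auto simp: permutes_id)
  obtain \<tau> where \<tau>: "bij_betw \<tau> {1..card K} K" "strict_mono_on {1..card K} \<tau>"
    using ex_strict_mono_enumeration finite_subset[OF K] by blast
  define \<delta> where
    "\<delta> = (\<lambda>i. if i \<in> K then \<sigma> (inv_into {1..card K} \<tau> i) else i)"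
  have \<delta>\<tau>: "\<delta> (\<tau> k) = \<sigma> k" if "k \<in> {1..card K}" for k
    using bij_betwE[OF \<tau>(1)] bij_betw_inv_into_left[OF \<tau>(1)] that by (simp add: \<delta>_def)
  have "bij_betw (\<sigma> \<circ> inv_into {1..card K} \<tau>) K K"
    using bij_betw_trans[OF bij_betw_inv_into[OF \<tau>(1)] \<sigma>] .
  then have "bij_betw \<delta> K K"
    by (rule bij_betw_cong[THEN iffD1, rotated]) (simp add: \<delta>_def)
  then have "\<delta> permutes K"
    by (rule bij_imp_permutes) (simp add: \<delta>_def)
  then have perm: "\<delta> permutes {1..n}"
    using K by (rule permutes_subset)
  \<comment> \<open>An increasing enumeration also sorts K by decreasing \<open>q\<close>, since
    \<open>q\<close> decreases in the index. Hence \<open>\<sigma>\<close> and \<open>\<tau>\<close>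
    have equal \<open>q\<close> at each position, which makes \<open>\<delta>\<close> preserve
    \<open>q\<close> on K.\<close>
  have anti_\<tau>: "q (\<tau> l) \<le> q (\<tau> k)" if "1 \<le> k" "k \<le> l" "l \<le> card K" for k l
  proof (rule anti)
    show "\<tau> k \<le> \<tau> l"
      using that strict_mono_on_leD[OF \<tau>(2)] by simp
    show "1 \<le> \<tau> k" "\<tau> l \<le> n"
      using bij_betwE[OF \<tau>(1)] K that by fastforce+
  qed
  have "q (\<delta> i) = q i" for i
  proof (cases "i \<in> K")
    case True
    then obtain k where k: "k \<in> {1..card K}" "i = \<tau> k"
      using \<tau>(1) unfolding bij_betw_def by blast
    then show ?thesis
      using sorted_rearrangement_unique[OF \<sigma> \<tau>(1) anti_\<sigma> anti_\<tau> k(1)] \<delta>\<tau> by simp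
  qed (simp add: \<delta>_def)
  then show ?thesis
    using natural perm eq[OF \<tau> perm \<delta>\<tau>] by blast
qed

end
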